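(* Let $\widetilde x$ be a cycle of the planar system $\dot x=f(x)$, $x\in\mathbb{R}^2$, of least period $T$, with $\dot{\widetilde x}_1(0)\neq0$ and $\dot{\widetilde x}_2(0)=0$. Assume that the algebraic multiplicity of the multiplier $+1$ of the $T$-periodic system $\dot y=f'(\widetilde x(t))y$ equals $2$. Then for all $s,\theta\in\mathbb{R}$ $$\Phi^s(\widetilde x(\theta))=\left(\widehat f(\theta)-\frac{\widehat z_2(T)}{\widetilde z_2(0)}\,\widetilde f(\theta,s+\theta)\right)\dot{\widetilde x}(\theta)+\widetilde f(\theta,0)\,\widehat y(\theta),$$ where $$\widetilde f(\theta,t)=\int_t^T\langle\widetilde z(\tau),g(\tau-\theta,\widetilde x(\tau),0)\rangle d\tau,\qquad \widehat f(\theta)=\int_0^T\langle\widehat z(\tau),g(\tau-\theta,\widetilde x(\tau),0)\rangle d\tau .$$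
   Context: $T>0$; $f:\mathbb{R}^2\to\mathbb{R}^2$ is continuously differentiable; $g:\mathbb{R}\times\mathbb{R}^2\times[0,1]\to\mathbb{R}^2$ is continuous and $T$-periodic in the first variable. $\Omega(\cdot,t_0,\xi)$ is the solution of $\dot x=f(x)$ with value $\xi$ at time $t_0$ (so $\Omega(t,0,\widetilde x(\theta))=\widetilde x(t+\theta)$). A cycle is a nonconstant periodic solution. Multipliers are the eigenvalues of the monodromy matrix over $[0,T]$. $\widehat y$ is a solution of $\dot y=f'(\widetilde x(t))y$ with $\widehat y_1(0)=0$, $\widehat y_2(0)\ne0$. $\widehat z,\widetilde z$ are the solutions of the adjoint system $\dot z=-(f'(\widetilde x(t)))^*z$ with $\widehat z(0)=(1/\dot{\widetilde x}_1(0),0)$, $\widetilde z(0)=(0,1/\widehat y_2(0))$. $\Phi^s(\xi)=\eta(T,s,\xi)-\eta(0,s,\xi)$, where $\eta(\cdot,s,\xi)$ is the solution of $\dot y=f'(\Omega(t,0,\xi))y+g(t,\Omega(t,0,\xi),0)$ with $\eta(s,s,\xi)=0$; for $\xi=\widetilde x(\theta)$ this formula is used for all $s\in\mathbb{R}$. *)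

theory Defs
  imports "HOL-Analysis.Analysis" "HOL-Computational_Algebra.Polynomial"
begin

definition solves_ode :: "(real \<Rightarrow> 'a::real_normed_vector \<Rightarrow> 'a) \<Rightarrow> (real \<Rightarrow> 'a) \<Rightarrow> bool" where
  "solves_ode F x \<longleftrightarrow> (\<forall>t. (x has_vector_derivative F t (x t)) (at t))"

(* The value at time t of the solution of x' = F t x with value x0 at time t0.  The solution is only
   required to live on the segment between t0 and t, so this is meaningful on the whole interval of
   existence even if no global solution exists.  It is unspecified if there is no solution up to
   time t or if the solutions disagree there. *)
definition ivp_solution ::
    "(real \<Rightarrow> 'a::real_normed_vector \<Rightarrow> 'a) \<Rightarrow> real \<Rightarrow> 'a \<Rightarrow> real \<Rightarrow> 'a" where
  "ivp_solution F t0 x0 t = (THE v. \<exists>x. x t0 = x0 \<and> x t = v \<and>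
     (\<forall>\<tau>\<in>closed_segment t0 t.
        (x has_vector_derivative F \<tau> (x \<tau>)) (at \<tau> within closed_segment t0 t)))"

definition cycle :: "('a::real_normed_vector \<Rightarrow> 'a) \<Rightarrow> (real \<Rightarrow> 'a) \<Rightarrow> bool" where
  "cycle f x \<longleftrightarrow> solves_ode (\<lambda>_. f) x \<and> (\<exists>p>0. \<forall>t. x (t + p) = x t) \<and> \<not> x constant_on UNIV"

definition least_period :: "(real \<Rightarrow> 'a) \<Rightarrow> real \<Rightarrow> bool" where
  "least_period x T \<longleftrightarrow> T > 0 \<and> (\<forall>t. x (t + T) = x t) \<and>
     (\<forall>p. 0 < p \<and> p < T \<longrightarrow> \<not> (\<forall>t. x (t + p) = x t))"

definition monodromy_matrix :: "(real \<Rightarrow> real^'n^'n) \<Rightarrow> real \<Rightarrow> real^'n^'n" where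
  "monodromy_matrix A T = ivp_solution (\<lambda>t Y. A t ** Y) 0 (mat 1) T"

definition characteristic_poly :: "real^'n^'n \<Rightarrow> real poly" where
  "characteristic_poly A = det (\<chi> i j. (if i = j then [:0, 1:] else 0) - [:A $ i $ j:])"

definition algebraic_multiplicity :: "real^'n^'n \<Rightarrow> real \<Rightarrow> nat" where
  "algebraic_multiplicity A \<mu> = order \<mu> (characteristic_poly A)"

definition Omega :: "(real^2 \<Rightarrow> real^2) \<Rightarrow> real \<Rightarrow> real \<Rightarrow> real^2 \<Rightarrow> real^2" where
  "Omega f t t0 \<xi> = ivp_solution (\<lambda>_. f) t0 \<xi> t"

(* Here and below, f' is the Jacobian matrix of f. *)
definition eta :: "(real^2 \<Rightarrow> real^2) \<Rightarrow> (real^2 \<Rightarrow> real^2^2) \<Rightarrow> (real \<Rightarrow> real^2 \<Rightarrow> real \<Rightarrow> real^2)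
    \<Rightarrow> real \<Rightarrow> real \<Rightarrow> real^2 \<Rightarrow> real^2" where
  "eta f f' g t s \<xi> =
     ivp_solution (\<lambda>\<tau> y. f' (Omega f \<tau> 0 \<xi>) *v y + g \<tau> (Omega f \<tau> 0 \<xi>) 0) s 0 t"

definition Phi :: "(real^2 \<Rightarrow> real^2) \<Rightarrow> (real^2 \<Rightarrow> real^2^2) \<Rightarrow> (real \<Rightarrow> real^2 \<Rightarrow> real \<Rightarrow> real^2)
    \<Rightarrow> real \<Rightarrow> real \<Rightarrow> real^2 \<Rightarrow> real^2" where
  "Phi f f' g T s \<xi> = eta f f' g T s \<xi> - eta f f' g 0 s \<xi>"

(* Oriented integrals: the lower limit t may exceed T. *)
definition f_tilde :: "(real \<Rightarrow> real^2) \<Rightarrow> (real \<Rightarrow> real^2 \<Rightarrow> real \<Rightarrow> real^2) \<Rightarrow> (real \<Rightarrow> real^2)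
    \<Rightarrow> real \<Rightarrow> real \<Rightarrow> real \<Rightarrow> real" where
  "f_tilde z_tilde g x T \<theta> t =
     (LBINT \<tau>=ereal t..ereal T. z_tilde \<tau> \<bullet> g (\<tau> - \<theta>) (x \<tau>) 0)"

definition f_hat :: "(real \<Rightarrow> real^2) \<Rightarrow> (real \<Rightarrow> real^2 \<Rightarrow> real \<Rightarrow> real^2) \<Rightarrow> (real \<Rightarrow> real^2)
    \<Rightarrow> real \<Rightarrow> real \<Rightarrow> real" where
  "f_hat z_hat g x T \<theta> =
     (LBINT \<tau>=ereal 0..ereal T. z_hat \<tau> \<bullet> g (\<tau> - \<theta>) (x \<tau>) 0)"

end

theory Submission
  imports Defs
begin

text \<open>The velocity \<^term>\<open>u\<close> of the cycle is a \<^term>\<open>T\<close>-periodic solution of the variational equation. At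
  time 0 it points along the first coordinate axis and \<^term>\<open>y_hat\<close> along the second one, so the
  monodromy matrix is upper triangular with first diagonal entry 1. As the multiplier 1 has algebraic
  multiplicity 2, the second diagonal entry is 1 as well
  (\<open>order_characteristic_poly_triangular\<close>), which means that
  \<^term>\<open>y_hat (t + T) = y_hat t + a *\<^sub>R u t\<close> for a constant \<^term>\<open>a\<close>.

  Inner products of solutions of the variational equation with solutions of the adjoint equation
  are constant (\<open>adjoint_inner_const\<close>), and the initial values make \<^term>\<open>z_hat\<close>, \<^term>\<open>z_tilde\<close> the basis
  dual to \<^term>\<open>u\<close>, \<^term>\<open>y_hat\<close> at every time. Consequently \<^term>\<open>z_tilde\<close> is periodic and
  \<^term>\<open>z_hat (t + T) = z_hat t - a *\<^sub>R z_tilde t\<close>; the second coordinate at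
  \<^term>\<open>t = (0::real)\<close> identifies the quotient in the claim with \<^term>\<open>- a\<close>. Along the cycle,
  shifting time by \<^term>\<open>\<theta>\<close> turns the equation that defines
  \<^const>\<open>eta\<close> into the variational equation of the cycle with a forcing term, which variation of constants
  solves in the basis \<^term>\<open>u\<close>, \<^term>\<open>y_hat\<close>. The claim then follows by shifting the windows of
  integration with the above periodicity relations (\<open>displacement_formula\<close>).

  Since \<^const>\<open>ivp_solution\<close> is a definite description, each of its values is computed from an
  explicit solution and a uniqueness theorem for locally Lipschitz right-hand sides
  (\<open>ivp_solution_eqI\<close>).\<close>

section \<open>Uniqueness for initial value problems\<close>

text \<open>The function \<^term>\<open>exp (- 2 * K * r) * (d r \<bullet> d r)\<close> is nonincreasing, vanishes at \<^term>\<open>0::real\<close> and is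
  nonnegative.\<close>

lemma Gronwall_unit_interval:
  fixes d d' :: "real \<Rightarrow> 'a::real_inner"
  assumes der: "\<And>r. r \<in> {0..1} \<Longrightarrow> (d has_vector_derivative d' r) (at r within {0..1})"
    and bound: "\<And>r. r \<in> {0..1} \<Longrightarrow> norm (d' r) \<le> K * norm (d r)"
    and zero: "d 0 = 0"
  shows "d 1 = 0"
proof -
  define \<phi> where "\<phi> r = exp (- (2 * K * r)) * (d r \<bullet> d r)" for r
  have "continuous_on {0..1} d"
    using der by (meson continuous_on_eq_continuous_within has_vector_derivative_continuous)
  then have cont: "continuous_on {0..1} \<phi>"
    unfolding \<phi>_def by (intro continuous_intros)
  have "\<phi> 1 \<le> \<phi> 0"
  proof (rule DERIV_nonpos_imp_decreasing_open[of 0 1 \<phi>])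
    fix r :: real assume r: "0 < r" "r < 1"
    then have "(d has_vector_derivative d' r) (at r)"
      using der[of r] by (simp add: at_within_Icc_at)
    then have "((\<lambda>r. d r \<bullet> d r) has_real_derivative 2 * (d r \<bullet> d' r)) (at r)"
      unfolding has_vector_derivative_def has_field_derivative_def
      by (auto intro!: derivative_eq_intros simp: inner_commute fun_eq_iff algebra_simps)
    then have "(\<phi> has_real_derivative
        exp (- (2 * K * r)) * (2 * (d r \<bullet> d' r) - 2 * K * (d r \<bullet> d r))) (at r)"
      unfolding \<phi>_def by (auto intro!: derivative_eq_intros simp: algebra_simps)
    moreover have "d r \<bullet> d' r \<le> K * (d r \<bullet> d r)"
    proof -
      have "d r \<bullet> d' r \<le> norm (d r) * norm (d' r)"
        by (rule norm_cauchy_schwarz)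
      also have "\<dots> \<le> norm (d r) * (K * norm (d r))"
        using bound[of r] r by (intro mult_left_mono) auto
      also have "\<dots> = K * (d r \<bullet> d r)"
        by (simp add: dot_square_norm power2_eq_square)
      finally show ?thesis .
    qed
    then have "exp (- (2 * K * r)) * (2 * (d r \<bullet> d' r) - 2 * K * (d r \<bullet> d r)) \<le> 0"
      by (simp add: mult_le_0_iff)
    ultimately show "\<exists>y. (\<phi> has_real_derivative y) (at r) \<and> y \<le> 0"
      by blast
  qed (use cont in auto)
  then show ?thesis
    using zero by (simp add: \<phi>_def mult_le_0_iff dot_square_norm)
qed

text \<open>Both trajectories stay in one ball on the compact segment, so a Lipschitz constant for that
  ball is enough. Running through the segment with a parameter in the unit interval treats
  \<^term>\<open>t0 \<le> t\<close> and \<^term>\<open>t \<le> t0\<close> at once; the factor \<^term>\<open>t - t0\<close> of the chain rule only enters through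
  its absolute value.\<close>

lemma ivp_unique:
  fixes F :: "real \<Rightarrow> 'a::real_inner \<Rightarrow> 'a" and t0 t :: real
  defines "S \<equiv> closed_segment t0 t"
  assumes lip: "\<And>R. \<exists>L. \<forall>\<tau>\<in>S. \<forall>a\<in>cball 0 R. \<forall>b\<in>cball 0 R.
      norm (F \<tau> a - F \<tau> b) \<le> L * norm (a - b)"
    and X: "\<And>\<tau>. \<tau> \<in> S \<Longrightarrow> (X has_vector_derivative F \<tau> (X \<tau>)) (at \<tau> within S)"
    and Y: "\<And>\<tau>. \<tau> \<in> S \<Longrightarrow> (Y has_vector_derivative F \<tau> (Y \<tau>)) (at \<tau> within S)"
    and init: "X t0 = Y t0"
  shows "X t = Y t"
proof -
  have "continuous_on S X" "continuous_on S Y"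
    using X Y by (meson continuous_on_eq_continuous_within has_vector_derivative_continuous)+
  moreover have "compact S"
    unfolding S_def by (rule compact_segment)
  ultimately have "bounded (X ` S \<union> Y ` S)"
    by (intro bounded_Un[THEN iffD2] conjI compact_imp_bounded compact_continuous_image)
  then obtain R where R: "X ` S \<union> Y ` S \<subseteq> cball 0 R"
    unfolding bounded_iff by (auto simp: subset_iff)
  obtain L where L: "\<forall>\<tau>\<in>S. \<forall>a\<in>cball 0 R. \<forall>b\<in>cball 0 R.
      norm (F \<tau> a - F \<tau> b) \<le> L * norm (a - b)"
    using lip by blast
  define p where "p r = t0 + r * (t - t0)" for r
  have p: "p ` {0..1} = S"
    unfolding S_def closed_segment_image_interval p_def
    by (intro image_cong) (auto simp: algebra_simps)
  have dp: "(p has_vector_derivative (t - t0)) (at r within {0..1})" for r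
    unfolding p_def by (auto intro!: derivative_eq_intros)
  define d where "d r = X (p r) - Y (p r)" for r
  have "d 1 = 0"
  proof (rule Gronwall_unit_interval)
    fix r :: real assume r: "r \<in> {0..1}"
    then have pS: "p r \<in> S"
      using p by auto
    have "((X \<circ> p) has_vector_derivative (t - t0) *\<^sub>R F (p r) (X (p r))) (at r within {0..1})"
      by (rule vector_diff_chain_within[OF dp]) (use X pS p in simp)
    moreover
    have "((Y \<circ> p) has_vector_derivative (t - t0) *\<^sub>R F (p r) (Y (p r))) (at r within {0..1})"
      by (rule vector_diff_chain_within[OF dp]) (use Y pS p in simp)
    ultimately
    show "(d has_vector_derivative (t - t0) *\<^sub>R (F (p r) (X (p r)) - F (p r) (Y (p r))))
        (at r within {0..1})"
      unfolding d_def scaleR_diff_right o_def by (intro derivative_intros)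
    show "norm ((t - t0) *\<^sub>R (F (p r) (X (p r)) - F (p r) (Y (p r)))) \<le> \<bar>t - t0\<bar> * L * norm (d r)"
      using L pS R unfolding d_def by (auto simp: image_subset_iff mult.assoc intro!: mult_left_mono)
  qed (simp add: d_def p_def init)
  then show ?thesis
    by (simp add: d_def p_def)
qed

lemma ivp_solution_eqI:
  fixes F :: "real \<Rightarrow> 'a::real_inner \<Rightarrow> 'a"
  assumes lip: "\<And>R. \<exists>L. \<forall>\<tau>\<in>closed_segment t0 t. \<forall>a\<in>cball 0 R. \<forall>b\<in>cball 0 R.
      norm (F \<tau> a - F \<tau> b) \<le> L * norm (a - b)"
    and X: "\<And>\<tau>. (X has_vector_derivative F \<tau> (X \<tau>)) (at \<tau>)"
    and init: "X t0 = x0"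
  shows "ivp_solution F t0 x0 t = X t"
  unfolding ivp_solution_def
proof (rule the_equality)
  show "\<exists>x. x t0 = x0 \<and> x t = X t \<and> (\<forall>\<tau>\<in>closed_segment t0 t.
      (x has_vector_derivative F \<tau> (x \<tau>)) (at \<tau> within closed_segment t0 t))"
    using X init by (intro exI[of _ X]) (auto intro: has_vector_derivative_at_within)
next
  fix v
  assume "\<exists>x. x t0 = x0 \<and> x t = v \<and> (\<forall>\<tau>\<in>closed_segment t0 t.
      (x has_vector_derivative F \<tau> (x \<tau>)) (at \<tau> within closed_segment t0 t))"
  then obtain Y where Y: "Y t0 = x0" "Y t = v" "\<forall>\<tau>\<in>closed_segment t0 t.
      (Y has_vector_derivative F \<tau> (Y \<tau>)) (at \<tau> within closed_segment t0 t)"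
    by blast
  have "Y t = X t"
    by (rule ivp_unique[where F = F and ?t0.0 = t0])
      (use lip Y X init in \<open>auto intro: has_vector_derivative_at_within\<close>)
  with Y show "v = X t"
    by simp
qed

text \<open>The product is an arbitrary bounded bilinear map so that the lemma covers both the vector
  equations and the matrix equation behind the monodromy matrix.\<close>

lemma affine_Lipschitz:
  fixes A :: "real \<Rightarrow> 'a::real_normed_vector" and pr :: "'a \<Rightarrow> 'b::real_normed_vector \<Rightarrow> 'b"
  assumes pr: "bounded_bilinear pr" and A: "continuous_on UNIV A"
  shows "\<exists>L. \<forall>\<tau>\<in>closed_segment t0 t. \<forall>a\<in>cball 0 R. \<forall>b\<in>cball 0 R.
      norm ((pr (A \<tau>) a + k \<tau>) - (pr (A \<tau>) b + k \<tau>)) \<le> L * norm (a - b)"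
proof -
  obtain K where K: "\<And>a b. norm (pr a b) \<le> norm a * norm b * K" "K \<ge> 0"
    using bounded_bilinear.nonneg_bounded[OF pr] by blast
  have "bounded (A ` closed_segment t0 t)"
    by (intro compact_imp_bounded compact_continuous_image compact_segment)
      (use A continuous_on_subset in blast)
  then obtain B where B: "\<And>\<tau>. \<tau> \<in> closed_segment t0 t \<Longrightarrow> norm (A \<tau>) \<le> B"
    by (auto simp: bounded_iff)
  show ?thesis
  proof (intro exI ballI)
    fix \<tau> and a b :: 'b assume "\<tau> \<in> closed_segment t0 t"
    then have "norm (A \<tau>) * norm (a - b) * K \<le> B * norm (a - b) * K"
      using B K by (intro mult_right_mono) auto
    then show "norm ((pr (A \<tau>) a + k \<tau>) - (pr (A \<tau>) b + k \<tau>)) \<le> B * K * norm (a - b)"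
      using K(1)[of "A \<tau>" "a - b"]
      by (simp add: bounded_bilinear.diff_right[OF pr] algebra_simps)
  qed
qed

lemma bounded_bilinear_matrix_vector_mult:
  "bounded_bilinear ((*v) :: real^'n^'m \<Rightarrow> real^'n \<Rightarrow> real^'m)"
proof -
  have "bilinear ((*v) :: real^'n^'m \<Rightarrow> real^'n \<Rightarrow> real^'m)"
    unfolding bilinear_def
    by (auto intro!: linearI simp: matrix_vector_right_distrib matrix_vector_mult_scaleR
        matrix_vector_mult_add_rdistrib scaleR_matrix_vector_assoc)
  then show ?thesis
    by (simp only: bilinear_conv_bounded_bilinear)
qed

lemma bounded_bilinear_matrix_matrix_mult:
  "bounded_bilinear ((**) :: real^'n^'m \<Rightarrow> real^'k^'n \<Rightarrow> real^'k^'m)"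
proof -
  have "bilinear ((**) :: real^'n^'m \<Rightarrow> real^'k^'n \<Rightarrow> real^'k^'m)"
    unfolding bilinear_def
    by (auto intro!: linearI simp: matrix_add_ldistrib matrix_matrix_mult_def vec_eq_iff
        sum.distrib sum_distrib_left algebra_simps)
  then show ?thesis
    by (simp only: bilinear_conv_bounded_bilinear)
qed

lemma C1_Lipschitz_on_cball:
  fixes f :: "real^'n \<Rightarrow> real^'m" and f' :: "real^'n \<Rightarrow> real^'n^'m"
  assumes f: "\<And>\<xi>. (f has_derivative (\<lambda>h. f' \<xi> *v h)) (at \<xi>)"
    and f': "continuous_on UNIV f'"
  shows "\<exists>L. \<forall>a\<in>cball 0 R. \<forall>b\<in>cball 0 R. norm (f a - f b) \<le> L * norm (a - b)"
proof -
  obtain K where K: "\<And>(a::real^'n^'m) b. norm (a *v b) \<le> norm a * norm b * K" "K \<ge> 0"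
    using bounded_bilinear.nonneg_bounded[OF bounded_bilinear_matrix_vector_mult] by blast
  have "bounded (f' ` cball 0 R)"
    by (intro compact_imp_bounded compact_continuous_image compact_cball)
      (use f' continuous_on_subset in blast)
  then obtain B where B: "\<And>\<xi>. \<xi> \<in> cball 0 R \<Longrightarrow> norm (f' \<xi>) \<le> B"
    unfolding bounded_iff by blast
  have onorm: "onorm (\<lambda>h. f' \<xi> *v h) \<le> B * K" if "\<xi> \<in> cball 0 R" for \<xi>
  proof (rule onorm_le)
    fix h :: "real^'n"
    have "norm (f' \<xi>) * norm h * K \<le> B * norm h * K"
      using B[OF that] K by (intro mult_right_mono) auto
    then show "norm (f' \<xi> *v h) \<le> B * K * norm h"
      using K(1)[of "f' \<xi>" h] by (simp add: algebra_simps)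
  qed
  have "norm (f a - f b) \<le> B * K * norm (a - b)" if "a \<in> cball 0 R" "b \<in> cball 0 R" for a b
    by (rule differentiable_bound[where S = "cball 0 R" and f' = "\<lambda>\<xi> h. f' \<xi> *v h"])
      (use that onorm f in \<open>auto intro: has_derivative_at_withinI simp: convex_cball\<close>)
  then show ?thesis
    by blast
qed

section \<open>Linear systems in the plane\<close>

text \<open>The two terms of the product rule cancel because the transposed matrix moves to the other
  side of the inner product.\<close>

lemma adjoint_inner_const:
  fixes A :: "real \<Rightarrow> real^'n^'n"
  assumes "solves_ode (\<lambda>t y. A t *v y) y"
    and "solves_ode (\<lambda>t z. - (transpose (A t) *v z)) z"
  shows "z t \<bullet> y t = z 0 \<bullet> y 0"
proof -
  have "((\<lambda>t. z t \<bullet> y t) has_vector_derivative 0) (at t)" for t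
  proof -
    have y: "(y has_vector_derivative A t *v y t) (at t)"
      and z: "(z has_vector_derivative - (transpose (A t) *v z t)) (at t)"
      using assms by (auto simp: solves_ode_def)
    have "((\<lambda>t. z t \<bullet> y t) has_vector_derivative
        z t \<bullet> (A t *v y t) + (- (transpose (A t) *v z t)) \<bullet> y t) (at t)"
      by (rule bounded_bilinear.has_vector_derivative[OF bounded_bilinear_inner z y])
    moreover have "(transpose (A t) *v z t) \<bullet> y t = z t \<bullet> (A t *v y t)"
      by (simp add: dot_lmul_matrix flip: vector_transpose_matrix)
    ultimately show ?thesis
      by simp
  qed
  then obtain c where "\<And>t. z t \<bullet> y t = c"
    using has_vector_derivative_zero_constant[of UNIV "\<lambda>t. z t \<bullet> y t"] by auto
  then show ?thesis
    by metis
qed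

text \<open>The hypotheses say that the matrix with rows \<^term>\<open>p\<close>, \<^term>\<open>q\<close> is a left inverse of the matrix with
  columns \<^term>\<open>a\<close>, \<^term>\<open>b\<close>; the two expansions say that it is also a right inverse.\<close>

lemma planar_dual_basis:
  fixes p q a b v :: "real^2"
  assumes "p \<bullet> a = 1" "p \<bullet> b = 0" "q \<bullet> a = 0" "q \<bullet> b = 1"
  shows "v = (p \<bullet> v) *\<^sub>R a + (q \<bullet> v) *\<^sub>R b"
    and "v = (v \<bullet> a) *\<^sub>R p + (v \<bullet> b) *\<^sub>R q"
proof -
  show "v = (p \<bullet> v) *\<^sub>R a + (q \<bullet> v) *\<^sub>R b"
    using assms unfolding vec_eq_iff inner_vec_def sum_2 forall_2 by simp algebra
  show "v = (v \<bullet> a) *\<^sub>R p + (v \<bullet> b) *\<^sub>R q"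
    using assms unfolding vec_eq_iff inner_vec_def sum_2 forall_2 by simp algebra
qed

text \<open>The characteristic polynomial is \<^term>\<open>[:-1, 1:] * [:- m, 1:]\<close>, where \<^term>\<open>m\<close> is the lower diagonal
  entry, so a double root at 1 forces \<^term>\<open>m = (1::real)\<close>.\<close>

lemma order_characteristic_poly_triangular:
  fixes M :: "real^2^2"
  assumes "M $ 1 $ 1 = 1" "M $ 2 $ 1 = 0" "algebraic_multiplicity M 1 = 2"
  shows "M $ 2 $ 2 = 1"
proof (rule ccontr)
  assume ne: "M $ 2 $ 2 \<noteq> 1"
  have "characteristic_poly M = [:- 1, 1:] * [:- (M $ 2 $ 2), 1:]"
    using assms(1,2) by (simp add: characteristic_poly_def det_2)
  moreover have "order 1 [:- 1, 1 :: real:] = 1"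
    using order_power_n_n[of "1::real" 1] by simp
  moreover have "order 1 [:- (M $ 2 $ 2), 1:] = 0"
    using ne by (intro order_0I) simp
  ultimately have "algebraic_multiplicity M 1 = 1"
    unfolding algebraic_multiplicity_def
    by (subst \<open>characteristic_poly M = _\<close>, subst order_mult) simp_all
  then show False
    using assms(3) by simp
qed

text \<open>Since \<^term>\<open>u 0\<close> and \<^term>\<open>y 0\<close> lie on the coordinate axes, rescaling the two solutions gives the
  columns of the fundamental matrix that starts at the identity.\<close>

lemma planar_monodromy:
  fixes A :: "real \<Rightarrow> real^2^2"
  assumes A: "continuous_on UNIV A"
    and u: "solves_ode (\<lambda>t y. A t *v y) u" "u 0 $ 1 \<noteq> 0" "u 0 $ 2 = 0"
    and y: "solves_ode (\<lambda>t y. A t *v y) y" "y 0 $ 1 = 0" "y 0 $ 2 \<noteq> 0"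
  shows "monodromy_matrix A T = (\<chi> i j. if j = 1 then u T $ i / u 0 $ 1 else y T $ i / y 0 $ 2)"
proof -
  define Y :: "real \<Rightarrow> real^2^2" where
    "Y t = (\<chi> i j. if j = 1 then u t $ i / u 0 $ 1 else y t $ i / y 0 $ 2)" for t
  have "monodromy_matrix A T = Y T"
    unfolding monodromy_matrix_def
  proof (rule ivp_solution_eqI)
    show "\<exists>L. \<forall>\<tau>\<in>closed_segment 0 T. \<forall>a\<in>cball 0 R. \<forall>b\<in>cball 0 R.
        norm (A \<tau> ** a - A \<tau> ** b) \<le> L * norm (a - b)" for R
      using affine_Lipschitz[OF bounded_bilinear_matrix_matrix_mult A, where k = "\<lambda>_. 0"] by simp
    show "Y 0 = mat 1"
      using u y by (simp add: Y_def mat_def vec_eq_iff forall_2)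
    fix t
    have comp: "((\<lambda>t. v t $ i) has_vector_derivative (A t *v v t) $ i) (at t)"
      if "solves_ode (\<lambda>t y. A t *v y) v" for v i
      using that unfolding solves_ode_def
      by (intro bounded_linear.has_vector_derivative[OF bounded_linear_vec_nth]) blast
    have sc: "((\<lambda>t. v t $ i / c) has_vector_derivative (A t *v v t) $ i / c) (at t)"
      if "solves_ode (\<lambda>t y. A t *v y) v" for v i c
      using bounded_linear.has_vector_derivative[OF bounded_linear_divide comp[OF that]] .
    have "((\<lambda>t. Y t $ i $ j) has_vector_derivative (A t ** Y t) $ i $ j) (at t)" for i j
      using sc[OF u(1), of i "u 0 $ 1"] sc[OF y(1), of i "y 0 $ 2"] exhaust_2[of j]
      by (auto simp: Y_def matrix_matrix_mult_def matrix_vector_mult_def sum_2 add_divide_distrib)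
    then have "((\<lambda>s. Y s \<bullet> b) has_derivative (\<lambda>h. (h *\<^sub>R (A t ** Y t)) \<bullet> b)) (at t)"
      if "b \<in> Basis" for b
      using that by (auto simp: Basis_vec_def inner_axis has_vector_derivative_def)
    then show "(Y has_vector_derivative A t ** Y t) (at t)"
      unfolding has_vector_derivative_def by (subst has_derivative_componentwise_within) blast
  qed
  then show ?thesis
    by (simp add: Y_def)
qed

section \<open>Displacement over a period\<close>

lemma antiderivative_obtain:
  fixes h :: "real \<Rightarrow> real"
  assumes "continuous_on UNIV h"
  obtains H where "\<And>t. (H has_vector_derivative h t) (at t)"
    and "\<And>a b. (LBINT \<tau>=ereal a..ereal b. h \<tau>) = H b - H a"
proof -
  obtain H where H: "\<And>t. (H has_vector_derivative h t) (at t)"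
    using einterval_antiderivative[of "-\<infinity>" \<infinity> h] assms
    by (auto simp: continuous_on_eq_continuous_at)
  moreover have "(LBINT \<tau>=ereal a..ereal b. h \<tau>) = H b - H a" for a b
    by (rule interval_integral_FTC_finite)
      (use H assms in \<open>auto intro: has_vector_derivative_at_within continuous_on_subset\<close>)
  ultimately show ?thesis
    using that by blast
qed

lemma has_vector_derivative_shift:
  assumes "\<And>t. (v has_vector_derivative v' t) (at t)"
  shows "((\<lambda>t. v (t + c)) has_vector_derivative v' (t + c)) (at (t::real))"
proof -
  have "((\<lambda>t. t + c) has_vector_derivative 1) (at t)"
    by (auto intro!: derivative_eq_intros)
  from vector_diff_chain_at[OF this assms] show ?thesis
    by (simp add: o_def)
qed

lemma eq_at_zero_if_derivative_zero:
  fixes v :: "real \<Rightarrow> 'a::real_normed_vector"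
  assumes "\<And>t. (v has_vector_derivative 0) (at t)"
  shows "v t = v 0"
  using has_vector_derivative_zero_constant[of UNIV v] assms by (metis UNIV_I convex_UNIV)

text \<open>Variation of constants: the solution of the forced system has the coordinates
  \<^term>\<open>H (t + \<theta>) - H (s + \<theta>)\<close> and \<^term>\<open>G (t + \<theta>) - G (s + \<theta>)\<close> in the moving basis \<^term>\<open>u\<close>, \<^term>\<open>y\<close>, where \<^term>\<open>H\<close> and
  \<^term>\<open>G\<close> are antiderivatives of \<^term>\<open>\<lambda>\<tau>. zh \<tau> \<bullet> k \<tau>\<close> and \<^term>\<open>\<lambda>\<tau>. zt \<tau> \<bullet> k \<tau>\<close>. The displacement over the
  period therefore involves integrals over \<^term>\<open>{\<theta>..\<theta> + T}\<close> and \<^term>\<open>{s + \<theta>..\<theta> + T}\<close>. The shear of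
  \<^term>\<open>y\<close> over a period is inherited by the dual basis with the opposite sign, which decides how
  these integrals change when the window is moved back to end at \<^term>\<open>T\<close>: the \<^term>\<open>G\<close>-integral over a
  period does not change, and the defect of the \<^term>\<open>H\<close>-integral is exactly what the shift of the
  upper limit produces in the term with the factor \<^term>\<open>a\<close>.\<close>

lemma displacement_formula:
  fixes A :: "real \<Rightarrow> real^2^2" and u y zh zt k :: "real \<Rightarrow> real^2"
    and T a s \<theta> :: real
  assumes A: "continuous_on UNIV A"
    and u: "solves_ode (\<lambda>t y. A t *v y) u" and y: "solves_ode (\<lambda>t y. A t *v y) y"
    and zh: "solves_ode (\<lambda>t z. - (transpose (A t) *v z)) zh"
    and zt: "solves_ode (\<lambda>t z. - (transpose (A t) *v z)) zt"
    and dual: "zh 0 \<bullet> u 0 = 1" "zh 0 \<bullet> y 0 = 0" "zt 0 \<bullet> u 0 = 0" "zt 0 \<bullet> y 0 = 1"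
    and u_per: "\<And>t. u (t + T) = u t" and y_per: "\<And>t. y (t + T) = y t + a *\<^sub>R u t"
    and k: "continuous_on UNIV k" "\<And>t. k (t + T) = k t"
  defines "w \<equiv> ivp_solution (\<lambda>\<tau> v. A (\<tau> + \<theta>) *v v + k (\<tau> + \<theta>)) s 0"
  shows "w T - w 0 =
      ((LBINT \<tau>=ereal 0..ereal T. zh \<tau> \<bullet> k \<tau>)
        + a * (LBINT \<tau>=ereal (s + \<theta>)..ereal T. zt \<tau> \<bullet> k \<tau>)) *\<^sub>R u \<theta>
      + (LBINT \<tau>=ereal 0..ereal T. zt \<tau> \<bullet> k \<tau>) *\<^sub>R y \<theta>"
proof -
  have d: "zh t \<bullet> u t = 1" "zh t \<bullet> y t = 0" "zt t \<bullet> u t = 0" "zt t \<bullet> y t = 1" for t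
    using adjoint_inner_const[OF u zh] adjoint_inner_const[OF y zh]
      adjoint_inner_const[OF u zt] adjoint_inner_const[OF y zt] dual by simp_all
  note dual_basis = planar_dual_basis[OF d]
  have zt_per: "zt (t + T) = zt t" for t
    using dual_basis(2)[of "zt (t + T)" t] d(3,4)[of "t + T"]
    by (simp add: u_per y_per inner_add_right)
  have zh_per: "zh (t + T) = zh t - a *\<^sub>R zt t" for t
  proof -
    have "zh (t + T) \<bullet> u t = 1" "zh (t + T) \<bullet> y t = - a"
      using d(1,2)[of "t + T"] by (simp_all add: u_per y_per inner_add_right)
    then show ?thesis
      using dual_basis(2)[of "zh (t + T)" t] by simp
  qed
  have "continuous_on UNIV zh" "continuous_on UNIV zt"
    using zh zt unfolding solves_ode_def
    by (meson continuous_at_imp_continuous_on has_vector_derivative_continuous)+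
  then have cont: "continuous_on UNIV (\<lambda>\<tau>. zh \<tau> \<bullet> k \<tau>)" "continuous_on UNIV (\<lambda>\<tau>. zt \<tau> \<bullet> k \<tau>)"
    using k by (auto intro: continuous_on_inner)
  obtain H where H: "\<And>t. (H has_vector_derivative zh t \<bullet> k t) (at t)"
    "\<And>a b. (LBINT \<tau>=ereal a..ereal b. zh \<tau> \<bullet> k \<tau>) = H b - H a"
    using antiderivative_obtain[OF cont(1)] by metis
  obtain G where G: "\<And>t. (G has_vector_derivative zt t \<bullet> k t) (at t)"
    "\<And>a b. (LBINT \<tau>=ereal a..ereal b. zt \<tau> \<bullet> k \<tau>) = G b - G a"
    using antiderivative_obtain[OF cont(2)] by metis
  have G_per: "G (t + T) - G t = G T - G 0" for t
  proof -
    have "((\<lambda>t. G (t + T) - G t) has_vector_derivative 0) (at t)" for t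
      using has_vector_derivative_diff[OF has_vector_derivative_shift[OF G(1), of T t] G(1)[of t]]
      by (simp add: zt_per k)
    from eq_at_zero_if_derivative_zero[OF this] show ?thesis
      by simp
  qed
  have H_per: "H (t + T) - H t + a * G t = H T - H 0 + a * G 0" for t
  proof -
    have "((\<lambda>t. H (t + T) - H t + a *\<^sub>R G t) has_vector_derivative
        zh (t + T) \<bullet> k (t + T) - zh t \<bullet> k t + a *\<^sub>R (zt t \<bullet> k t)) (at t)" for t
      by (intro has_vector_derivative_add has_vector_derivative_diff
          bounded_linear.has_vector_derivative[OF bounded_linear_scaleR_right]
          has_vector_derivative_shift[OF H(1)] H(1) G(1))
    then have "((\<lambda>t. H (t + T) - H t + a *\<^sub>R G t) has_vector_derivative 0) (at t)" for t
      by (simp add: zh_per k inner_diff_left)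
    from eq_at_zero_if_derivative_zero[OF this] show ?thesis
      by simp
  qed
  define W where "W t = (H (t + \<theta>) - H (s + \<theta>)) *\<^sub>R u (t + \<theta>)
      + (G (t + \<theta>) - G (s + \<theta>)) *\<^sub>R y (t + \<theta>)" for t
  have w: "w t = W t" for t
    unfolding w_def
  proof (rule ivp_solution_eqI)
    have "continuous_on UNIV (\<lambda>\<tau>. A (\<tau> + \<theta>))"
      by (intro continuous_on_compose2[OF A] continuous_intros) auto
    then show "\<exists>L. \<forall>\<tau>\<in>closed_segment s t. \<forall>a\<in>cball 0 R. \<forall>b\<in>cball 0 R.
        norm (A (\<tau> + \<theta>) *v a + k (\<tau> + \<theta>) - (A (\<tau> + \<theta>) *v b + k (\<tau> + \<theta>)))
          \<le> L * norm (a - b)" for R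
      by (rule affine_Lipschitz[OF bounded_bilinear_matrix_vector_mult])
    show "W s = 0"
      by (simp add: W_def)
    fix \<tau>
    let ?r = "\<tau> + \<theta>"
    have du: "((\<lambda>t. u (t + \<theta>)) has_vector_derivative A ?r *v u ?r) (at \<tau>)"
      and dy: "((\<lambda>t. y (t + \<theta>)) has_vector_derivative A ?r *v y ?r) (at \<tau>)"
      using u y by (auto simp: solves_ode_def intro: has_vector_derivative_shift)
    have dH: "((\<lambda>t. H (t + \<theta>) - H (s + \<theta>)) has_vector_derivative zh ?r \<bullet> k ?r) (at \<tau>)"
      and dG: "((\<lambda>t. G (t + \<theta>) - G (s + \<theta>)) has_vector_derivative zt ?r \<bullet> k ?r) (at \<tau>)"
      using has_vector_derivative_diff[OF has_vector_derivative_shift[OF H(1)]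
          has_vector_derivative_const]
        has_vector_derivative_diff[OF has_vector_derivative_shift[OF G(1)]
          has_vector_derivative_const]
      by simp_all
    have "(W has_vector_derivative
        ((H ?r - H (s + \<theta>)) *\<^sub>R (A ?r *v u ?r) + (zh ?r \<bullet> k ?r) *\<^sub>R u ?r)
        + ((G ?r - G (s + \<theta>)) *\<^sub>R (A ?r *v y ?r) + (zt ?r \<bullet> k ?r) *\<^sub>R y ?r)) (at \<tau>)"
      unfolding W_def
      by (intro has_vector_derivative_add
          bounded_bilinear.has_vector_derivative[OF bounded_bilinear_scaleR] du dy dH dG)
    moreover have "((H ?r - H (s + \<theta>)) *\<^sub>R (A ?r *v u ?r) + (zh ?r \<bullet> k ?r) *\<^sub>R u ?r)
        + ((G ?r - G (s + \<theta>)) *\<^sub>R (A ?r *v y ?r) + (zt ?r \<bullet> k ?r) *\<^sub>R y ?r)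
        = A ?r *v W \<tau> + k ?r"
      using dual_basis(1)[of "k ?r" ?r]
      by (simp add: W_def matrix_vector_right_distrib matrix_vector_mult_scaleR)
    ultimately show "(W has_vector_derivative A ?r *v W \<tau> + k ?r) (at \<tau>)"
      by simp
  qed
  have "W T - W 0 = (H (\<theta> + T) - H \<theta> + a * (G (\<theta> + T) - G (s + \<theta>))) *\<^sub>R u \<theta>
      + (G (\<theta> + T) - G \<theta>) *\<^sub>R y \<theta>"
  proof -
    have T\<theta>: "T + \<theta> = \<theta> + T"
      by simp
    show ?thesis
      unfolding W_def T\<theta> u_per y_per add_0 by (simp add: algebra_simps)
  qed
  moreover have "H (\<theta> + T) - H \<theta> + a * (G (\<theta> + T) - G (s + \<theta>))
      = H T - H 0 + a * (G T - G (s + \<theta>))"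
  proof -
    have eqs: "G (\<theta> + T) = G \<theta> + (G T - G 0)" "H (\<theta> + T) = H \<theta> - a * G \<theta> + (H T - H 0 + a * G 0)"
      using G_per[of \<theta>] H_per[of \<theta>] by simp_all
    show ?thesis
      unfolding eqs by (simp add: algebra_simps)
  qed
  ultimately show ?thesis
    by (simp add: w H(2) G(2) G_per)
qed

theorem mainTheorem8:
  fixes T :: real
    and f :: "real^2 \<Rightarrow> real^2"
    and f' :: "real^2 \<Rightarrow> real^2^2"
    and g :: "real \<Rightarrow> real^2 \<Rightarrow> real \<Rightarrow> real^2"
    and x y_hat z_hat z_tilde :: "real \<Rightarrow> real^2"
  assumes "T > 0"
    and "\<And>\<xi>. (f has_derivative (\<lambda>h. f' \<xi> *v h)) (at \<xi>)"
    and "continuous_on UNIV f'"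
    and "continuous_on (UNIV \<times> UNIV \<times> {0..1}) (\<lambda>(t, \<xi>, \<epsilon>). g t \<xi> \<epsilon>)"
    and "\<And>t \<xi> \<epsilon>. \<epsilon> \<in> {0..1} \<Longrightarrow> g (t + T) \<xi> \<epsilon> = g t \<xi> \<epsilon>"
    and "cycle f x"
    and "least_period x T"
    and "vector_derivative x (at 0) $ 1 \<noteq> 0"
    and "vector_derivative x (at 0) $ 2 = 0"
    and "algebraic_multiplicity (monodromy_matrix (\<lambda>t. f' (x t)) T) 1 = 2"
    and "solves_ode (\<lambda>t y. f' (x t) *v y) y_hat"
    and "y_hat 0 $ 1 = 0"
    and "y_hat 0 $ 2 \<noteq> 0"
    and "solves_ode (\<lambda>t z. - (transpose (f' (x t)) *v z)) z_hat"
    and "z_hat 0 = vector [1 / (vector_derivative x (at 0) $ 1), 0]"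
    and "solves_ode (\<lambda>t z. - (transpose (f' (x t)) *v z)) z_tilde"
    and "z_tilde 0 = vector [0, 1 / (y_hat 0 $ 2)]"
  shows "\<forall>s \<theta>. Phi f f' g T s (x \<theta>) =
    (f_hat z_hat g x T \<theta> - z_hat T $ 2 / z_tilde 0 $ 2 * f_tilde z_tilde g x T \<theta> (s + \<theta>))
      *\<^sub>R vector_derivative x (at \<theta>)
    + f_tilde z_tilde g x T \<theta> 0 *\<^sub>R y_hat \<theta>"
proof (intro allI)
  fix s \<theta> :: real
  note f_der = assms(2) and f'_cont = assms(3) and g_cont = assms(4) and g_per = assms(5)
  note y0 = assms(12,13)
  define u where "u t = vector_derivative x (at t)" for t
  define A where "A t = f' (x t)" for t
  define k where "k \<tau> = g (\<tau> - \<theta>) (x \<tau>) 0" for \<tau>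
  have x_der: "(x has_vector_derivative f (x t)) (at t)" for t
    using assms(6) by (simp add: cycle_def solves_ode_def)
  have x_per: "x (t + T) = x t" for t
    using assms(7) by (simp add: least_period_def)
  have x_cont: "continuous_on UNIV x"
    using x_der by (meson continuous_at_imp_continuous_on has_vector_derivative_continuous)
  have u_eq: "u t = f (x t)" for t
    unfolding u_def by (rule vector_derivative_at[OF x_der])
  have u_ode: "solves_ode (\<lambda>t y. A t *v y) u"
    unfolding solves_ode_def A_def
  proof
    fix t
    have "((f \<circ> x) has_vector_derivative f' (x t) *v f (x t)) (at t)"
      using diff_chain_at[OF x_der[of t, unfolded has_vector_derivative_def] f_der]
      by (simp add: has_vector_derivative_def o_def matrix_vector_mult_scaleR)
    moreover have "u = f \<circ> x"
      by (simp add: fun_eq_iff u_eq)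
    ultimately show "(u has_vector_derivative f' (x t) *v u t) (at t)"
      by (simp add: u_eq)
  qed
  have u0: "u 0 $ 1 \<noteq> 0" "u 0 $ 2 = 0"
    using assms(8,9) by (simp_all add: u_def)
  have u_per: "u (t + T) = u t" for t
    by (simp add: u_eq x_per)
  have A_cont: "continuous_on UNIV A"
    unfolding A_def by (intro continuous_on_compose2[OF f'_cont x_cont]) auto
  have A_per: "A (t + T) = A t" for t
    by (simp add: A_def x_per)
  have y_ode': "solves_ode (\<lambda>t y. A t *v y) y_hat"
    and zh: "solves_ode (\<lambda>t z. - (transpose (A t) *v z)) z_hat"
    and zt: "solves_ode (\<lambda>t z. - (transpose (A t) *v z)) z_tilde"
    using assms(11,14,16) by (simp_all add: A_def)

  define M where "M = monodromy_matrix A T"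
  have M: "M = (\<chi> i j. if j = 1 then u T $ i / u 0 $ 1 else y_hat T $ i / y_hat 0 $ 2)"
    unfolding M_def by (rule planar_monodromy[OF A_cont u_ode u0 y_ode' y0])
  have uT: "u T = u 0"
    using u_per[of 0] by simp
  have "M $ 2 $ 2 = 1"
  proof (rule order_characteristic_poly_triangular)
    show "M $ 1 $ 1 = 1" "M $ 2 $ 1 = 0"
      using u0 by (simp_all add: M uT)
    show "algebraic_multiplicity M 1 = 2"
      using assms(10) by (simp add: M_def A_def[abs_def])
  qed
  then have yT2: "y_hat T $ 2 = y_hat 0 $ 2"
    using y0 by (simp add: M)
  define a where "a = y_hat T $ 1 / u 0 $ 1"
  have yT: "y_hat T = y_hat 0 + a *\<^sub>R u 0"
    using u0 y0 yT2 by (simp add: vec_eq_iff forall_2 a_def)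
  have y_per: "y_hat (t + T) = y_hat t + a *\<^sub>R u t" for t
  proof (rule ivp_unique[where F = "\<lambda>t v. A t *v v" and ?t0.0 = 0])
    show "\<exists>L. \<forall>\<tau>\<in>closed_segment 0 t. \<forall>a\<in>cball 0 R. \<forall>b\<in>cball 0 R.
        norm (A \<tau> *v a - A \<tau> *v b) \<le> L * norm (a - b)" for R
      using affine_Lipschitz[OF bounded_bilinear_matrix_vector_mult A_cont, where k = "\<lambda>_. 0"]
      by simp
    fix \<tau>
    have "((\<lambda>t. y_hat (t + T)) has_vector_derivative A (\<tau> + T) *v y_hat (\<tau> + T)) (at \<tau>)"
      by (rule has_vector_derivative_shift) (use y_ode' in \<open>simp add: solves_ode_def\<close>)
    then show "((\<lambda>t. y_hat (t + T)) has_vector_derivative A \<tau> *v y_hat (\<tau> + T))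
        (at \<tau> within closed_segment 0 t)"
      by (simp add: A_per has_vector_derivative_at_within)
    have "((\<lambda>t. y_hat t + a *\<^sub>R u t) has_vector_derivative
        A \<tau> *v y_hat \<tau> + a *\<^sub>R (A \<tau> *v u \<tau>)) (at \<tau>)"
      using y_ode' u_ode unfolding solves_ode_def
      by (intro has_vector_derivative_add
          bounded_linear.has_vector_derivative[OF bounded_linear_scaleR_right]) auto
    then show "((\<lambda>t. y_hat t + a *\<^sub>R u t) has_vector_derivative A \<tau> *v (y_hat \<tau> + a *\<^sub>R u \<tau>))
        (at \<tau> within closed_segment 0 t)"
      by (simp add: matrix_vector_right_distrib matrix_vector_mult_scaleR
          has_vector_derivative_at_within)
  qed (simp add: yT)

  have dual: "z_hat 0 \<bullet> u 0 = 1" "z_hat 0 \<bullet> y_hat 0 = 0"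
      "z_tilde 0 \<bullet> u 0 = 0" "z_tilde 0 \<bullet> y_hat 0 = 1"
    using u0 y0 unfolding assms(15,17) by (simp_all add: inner_vec_def sum_2 flip: u_def)
  have ratio: "z_hat T $ 2 / z_tilde 0 $ 2 = - a"
  proof -
    have "z_hat T \<bullet> u 0 = 1" "z_hat T \<bullet> y_hat T = 0"
      using adjoint_inner_const[OF u_ode zh, of T] adjoint_inner_const[OF y_ode' zh, of T] dual
      by (simp_all add: uT)
    then have "z_hat T \<bullet> y_hat 0 = - a"
      by (simp add: yT inner_add_right)
    then show ?thesis
      using y0 by (simp add: assms(17) inner_vec_def sum_2)
  qed

  have k_cont: "continuous_on UNIV k"
    unfolding k_def
  proof -
    have "continuous_on UNIV (\<lambda>\<tau>. (\<tau> - \<theta>, x \<tau>, 0::real))"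
      by (intro continuous_intros x_cont)
    then have "continuous_on UNIV
        (\<lambda>\<tau>. case (\<tau> - \<theta>, x \<tau>, 0) of (t, \<xi>, \<epsilon>) \<Rightarrow> g t \<xi> \<epsilon>)"
      by (rule continuous_on_compose2[OF g_cont]) auto
    then show "continuous_on UNIV (\<lambda>\<tau>. g (\<tau> - \<theta>) (x \<tau>) 0)"
      by simp
  qed
  have k_per: "k (\<tau> + T) = k \<tau>" for \<tau>
    using g_per[of 0 "\<tau> - \<theta>" "x \<tau>"] by (simp add: k_def x_per diff_add_eq)
  have Omega: "Omega f \<tau> 0 (x \<theta>) = x (\<tau> + \<theta>)" for \<tau>
    unfolding Omega_def
  proof (rule ivp_solution_eqI)
    show "\<exists>L. \<forall>\<tau>\<in>closed_segment 0 \<tau>. \<forall>a\<in>cball 0 R. \<forall>b\<in>cball 0 R.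
        norm (f a - f b) \<le> L * norm (a - b)" for R
      using C1_Lipschitz_on_cball[OF f_der f'_cont, of R] by blast
  qed (use has_vector_derivative_shift[OF x_der] in auto)
  have "eta f f' g t s (x \<theta>)
      = ivp_solution (\<lambda>\<tau> v. A (\<tau> + \<theta>) *v v + k (\<tau> + \<theta>)) s 0 t" for t
    unfolding eta_def by (simp add: Omega A_def k_def)
  then have "Phi f f' g T s (x \<theta>) =
      ((LBINT \<tau>=ereal 0..ereal T. z_hat \<tau> \<bullet> k \<tau>)
        + a * (LBINT \<tau>=ereal (s + \<theta>)..ereal T. z_tilde \<tau> \<bullet> k \<tau>)) *\<^sub>R u \<theta>
      + (LBINT \<tau>=ereal 0..ereal T. z_tilde \<tau> \<bullet> k \<tau>) *\<^sub>R y_hat \<theta>"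
    unfolding Phi_def
    using displacement_formula[OF A_cont u_ode y_ode' zh zt dual u_per y_per k_cont k_per] by simp
  then show "Phi f f' g T s (x \<theta>) =
      (f_hat z_hat g x T \<theta> - z_hat T $ 2 / z_tilde 0 $ 2 * f_tilde z_tilde g x T \<theta> (s + \<theta>))
        *\<^sub>R vector_derivative x (at \<theta>)
      + f_tilde z_tilde g x T \<theta> 0 *\<^sub>R y_hat \<theta>"
    unfolding f_hat_def f_tilde_def ratio k_def u_def by simp
qed

end
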